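(* Let $\varphi$ be a $w^*$-continuous completely positive linear map on $B(\mathcal H)$. The following are equivalent: (i) $\varphi$ is similar to a pure completely positive linear map $\psi$ with $\|\psi\|\le1$; (ii) there exist constants $0<a\le b$ and a positive operator $R\in B(\mathcal H)$ with $aI\le\sum_{k=0}^\infty\varphi^k(R)\le bI$; (iii) there is an invertible pure solution of the inequality $\varphi(X)\le X$.
   Context: Two linear maps $\varphi,\lambda$ on $B(\mathcal H)$ are similar if there is an invertible $R\in B(\mathcal H)$ with $\varphi(RXR^* )=R\lambda(X)R^*$ for all $X$. A positive map $\psi$ is pure if $\psi^k(I)\to0$ strongly. A pure solution of $\varphi(X)\le X$ is a $C\ge0$ with $\varphi(C)\le C$ and $\varphi^k(C)\to0$ strongly. *)

theory Defs
  imports "HOL-Analysis.Analysis"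
begin

class scaleC =
  fixes scaleC :: "complex \<Rightarrow> 'a \<Rightarrow> 'a" (infixr \<open>*\<^sub>C\<close> 75)

class complex_inner = real_normed_vector + scaleC +
  fixes cinner :: "'a \<Rightarrow> 'a \<Rightarrow> complex"
  assumes scaleC_add_right: "a *\<^sub>C (x + y) = a *\<^sub>C x + a *\<^sub>C y"
    and scaleC_add_left: "(a + b) *\<^sub>C x = a *\<^sub>C x + b *\<^sub>C x"
    and scaleC_scaleC: "a *\<^sub>C (b *\<^sub>C x) = (a * b) *\<^sub>C x"
    and scaleC_one: "1 *\<^sub>C x = x"
    and scaleR_scaleC: "scaleR r x = complex_of_real r *\<^sub>C x"
    and cinner_commute: "cinner x y = cnj (cinner y x)"
    and cinner_add_left: "cinner (x + y) z = cinner x z + cinner y z"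
    and cinner_scaleC_left: "cinner (a *\<^sub>C x) y = cnj a * cinner x y"
    and cinner_ge_zero: "0 \<le> Re (cinner x x)"
    and cinner_eq_zero_iff: "cinner x x = 0 \<longleftrightarrow> x = 0"
    and norm_eq_sqrt_cinner: "norm x = sqrt (Re (cinner x x))"

class chilbert_space = complex_inner + complete_space

text \<open>Elements of B(H) are represented as functions H => H satisfying \<open>bop\<close>.\<close>
definition bop :: "('a::chilbert_space \<Rightarrow> 'a) \<Rightarrow> bool" where
  "bop T \<longleftrightarrow> (\<forall>x y. T (x + y) = T x + T y) \<and> (\<forall>c x. T (c *\<^sub>C x) = c *\<^sub>C T x)
     \<and> (\<exists>K. \<forall>x. norm (T x) \<le> K * norm x)"

definition adj :: "('a::chilbert_space \<Rightarrow> 'a) \<Rightarrow> ('a \<Rightarrow> 'a)" where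
  "adj T = (THE S. \<forall>x y. cinner (T x) y = cinner x (S y))"

definition invertible_op :: "('a::chilbert_space \<Rightarrow> 'a) \<Rightarrow> bool" where
  "invertible_op R \<longleftrightarrow> bop R \<and> (\<exists>S. bop S \<and> R \<circ> S = id \<and> S \<circ> R = id)"

definition cnonneg :: "complex \<Rightarrow> bool" where
  "cnonneg z \<longleftrightarrow> Im z = 0 \<and> 0 \<le> Re z"

definition pos_op :: "('a::chilbert_space \<Rightarrow> 'a) \<Rightarrow> bool" where
  "pos_op X \<longleftrightarrow> bop X \<and> (\<forall>x. cnonneg (cinner x (X x)))"

definition op_le :: "('a::chilbert_space \<Rightarrow> 'a) \<Rightarrow> ('a \<Rightarrow> 'a) \<Rightarrow> bool" where
  "op_le X Y \<longleftrightarrow> bop X \<and> bop Y \<and> pos_op (\<lambda>x. Y x - X x)"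

definition strongly_to_zero :: "(nat \<Rightarrow> ('a::chilbert_space \<Rightarrow> 'a)) \<Rightarrow> bool" where
  "strongly_to_zero T \<longleftrightarrow> (\<forall>x. (\<lambda>k. T k x) \<longlonglongrightarrow> 0)"

definition linear_map_BH :: "(('a::chilbert_space \<Rightarrow> 'a) \<Rightarrow> ('a \<Rightarrow> 'a)) \<Rightarrow> bool" where
  "linear_map_BH \<phi> \<longleftrightarrow> (\<forall>X. bop X \<longrightarrow> bop (\<phi> X))
     \<and> (\<forall>X Y. bop X \<longrightarrow> bop Y \<longrightarrow> \<phi> (\<lambda>x. X x + Y x) = (\<lambda>x. \<phi> X x + \<phi> Y x))
     \<and> (\<forall>c X. bop X \<longrightarrow> \<phi> (\<lambda>x. c *\<^sub>C X x) = (\<lambda>x. c *\<^sub>C \<phi> X x))"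

definition pos_opmatrix :: "nat \<Rightarrow> (nat \<Rightarrow> nat \<Rightarrow> ('a::chilbert_space \<Rightarrow> 'a)) \<Rightarrow> bool" where
  "pos_opmatrix n X \<longleftrightarrow> (\<forall>i<n. \<forall>j<n. bop (X i j)) \<and>
     (\<forall>v :: nat \<Rightarrow> 'a. cnonneg (\<Sum>i<n. \<Sum>j<n. cinner (v i) (X i j (v j))))"

definition completely_positive :: "(('a::chilbert_space \<Rightarrow> 'a) \<Rightarrow> ('a \<Rightarrow> 'a)) \<Rightarrow> bool" where
  "completely_positive \<phi> \<longleftrightarrow> linear_map_BH \<phi> \<and>
     (\<forall>n X. pos_opmatrix n X \<longrightarrow> pos_opmatrix n (\<lambda>i j. \<phi> (X i j)))"

text \<open>Normal functionals omega_{x,y}(X) = sum_k <x_k, X y_k> with square-summable x, y.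
  They generate the w*-(sigma-weak) topology on B(H).\<close>
definition normal_index :: "((nat \<Rightarrow> 'a::chilbert_space) \<times> (nat \<Rightarrow> 'a)) set" where
  "normal_index = {(x, y). summable (\<lambda>k. (norm (x k))\<^sup>2) \<and> summable (\<lambda>k. (norm (y k))\<^sup>2)}"

definition normal_functional ::
    "(nat \<Rightarrow> 'a::chilbert_space) \<times> (nat \<Rightarrow> 'a) \<Rightarrow> ('a \<Rightarrow> 'a) \<Rightarrow> complex" where
  "normal_functional \<omega> X = (\<Sum>k. cinner (fst \<omega> k) (X (snd \<omega> k)))"

definition wstar_topology :: "('a::chilbert_space \<Rightarrow> 'a) topology" where
  "wstar_topology = pullback_topology {T. bop T}
      (\<lambda>X. restrict (\<lambda>\<omega>. normal_functional \<omega> X) normal_index)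
      (product_topology (\<lambda>_. euclidean) normal_index)"

definition wstar_continuous :: "(('a::chilbert_space \<Rightarrow> 'a) \<Rightarrow> ('a \<Rightarrow> 'a)) \<Rightarrow> bool" where
  "wstar_continuous \<phi> \<longleftrightarrow> continuous_map wstar_topology wstar_topology \<phi>"

definition similar_maps :: "(('a::chilbert_space \<Rightarrow> 'a) \<Rightarrow> ('a \<Rightarrow> 'a)) \<Rightarrow> (('a \<Rightarrow> 'a) \<Rightarrow> ('a \<Rightarrow> 'a)) \<Rightarrow> bool" where
  "similar_maps \<phi> \<mu> \<longleftrightarrow> (\<exists>R. invertible_op R \<and>
     (\<forall>X. bop X \<longrightarrow> \<phi> (R \<circ> X \<circ> adj R) = R \<circ> \<mu> X \<circ> adj R))"

definition pure_map :: "(('a::chilbert_space \<Rightarrow> 'a) \<Rightarrow> ('a \<Rightarrow> 'a)) \<Rightarrow> bool" where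
  "pure_map \<psi> \<longleftrightarrow> strongly_to_zero (\<lambda>k. (\<psi> ^^ k) id)"

definition map_norm_le_one :: "(('a::chilbert_space \<Rightarrow> 'a) \<Rightarrow> ('a \<Rightarrow> 'a)) \<Rightarrow> bool" where
  "map_norm_le_one \<psi> \<longleftrightarrow> (\<forall>X. bop X \<longrightarrow> onorm (\<psi> X) \<le> onorm X)"

definition pure_solution :: "(('a::chilbert_space \<Rightarrow> 'a) \<Rightarrow> ('a \<Rightarrow> 'a)) \<Rightarrow> ('a \<Rightarrow> 'a) \<Rightarrow> bool" where
  "pure_solution \<phi> C \<longleftrightarrow> pos_op C \<and> op_le (\<phi> C) C \<and> strongly_to_zero (\<lambda>k. (\<phi> ^^ k) C)"

end

theory Submission
  imports Defs
begin

text \<open>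
  If \<open>\<phi>(R X R\<^sup>*) = R \<psi>(X) R\<^sup>*\<close> with \<open>\<psi>\<close> pure and contractive, then \<open>C = R R\<^sup>*\<close> is an invertible pure
  solution, as \<open>\<phi>\<^sup>k(C) = R \<psi>\<^sup>k(I) R\<^sup>*\<close>. Conversely, for an invertible pure solution \<open>C = B\<^sup>2\<close> put
  \<open>\<psi>(X) = B\<^sup>-\<^sup>1 \<phi>(B X B) B\<^sup>-\<^sup>1\<close>; then \<open>\<psi>(I) \<le> I\<close>, and two-positivity gives \<open>\<parallel>\<psi>\<parallel> \<le> 1\<close>. Pure solutions \<open>C\<close>
  and series correspond through \<open>R = C - \<phi>(C)\<close> and the telescoping identity
  \<open>\<Sum>k<n. \<phi>\<^sup>k(R) = C - \<phi>\<^sup>n(C)\<close>. To recover \<open>\<phi>(S) = S - R\<close> from \<open>S = \<Sum>k. \<phi>\<^sup>k(R)\<close>, the partial sums are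
  bounded and converge strongly, hence in the weak* topology, in which \<open>\<phi>\<close> is continuous.
\<close>

subsection \<open>The inner product\<close>

text \<open>Makes the bounded linear maps on the space a complete metric space, as the fixed-point
  construction of square roots requires.\<close>

instance chilbert_space \<subseteq> banach ..

lemma scaleC_minus_one: "(- 1) *\<^sub>C x = - (x::'a::complex_inner)"
  using scaleR_scaleC[of "-1" x] by simp

lemma scaleC_zero_right [simp]: "c *\<^sub>C (0::'a::complex_inner) = 0"
  using scaleC_add_right[of c "0::'a" 0] by simp

lemma cinner_add_right: "cinner x (y + z) = cinner x y + cinner x (z::'a::complex_inner)"
  by (metis cinner_add_left cinner_commute complex_cnj_add)

lemma cinner_scaleC_right: "cinner x (c *\<^sub>C y) = c * cinner x (y::'a::complex_inner)"
  by (metis cinner_commute cinner_scaleC_left complex_cnj_cnj complex_cnj_mult)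

lemma cinner_scaleR_left: "cinner (r *\<^sub>R x) y = of_real r * cinner x (y::'a::complex_inner)"
  by (simp add: scaleR_scaleC cinner_scaleC_left)

lemma cinner_scaleR_right: "cinner x (r *\<^sub>R y) = of_real r * cinner x (y::'a::complex_inner)"
  by (simp add: scaleR_scaleC cinner_scaleC_right)

lemma cinner_minus_left: "cinner (- x) y = - cinner x (y::'a::complex_inner)"
  using cinner_scaleR_left[of "-1" x y] by simp

lemma cinner_minus_right: "cinner x (- y) = - cinner x (y::'a::complex_inner)"
  using cinner_scaleR_right[of x "-1" y] by simp

lemma cinner_diff_left: "cinner (x - y) z = cinner x z - cinner y (z::'a::complex_inner)"
  using cinner_add_left[of x "-y" z] by (simp add: cinner_minus_left)

lemma cinner_diff_right: "cinner x (y - z) = cinner x y - cinner x (z::'a::complex_inner)"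
  using cinner_add_right[of x y "-z"] by (simp add: cinner_minus_right)

lemma cinner_zero_left [simp]: "cinner 0 (x::'a::complex_inner) = 0"
  using cinner_scaleR_left[of 0 x x] by simp

lemma cinner_zero_right [simp]: "cinner x (0::'a::complex_inner) = 0"
  using cinner_scaleR_right[of x 0 x] by simp

lemmas cinner_simps = cinner_add_left cinner_add_right cinner_diff_left cinner_diff_right
  cinner_scaleC_left cinner_scaleC_right cinner_scaleR_left cinner_scaleR_right
  cinner_minus_left cinner_minus_right

lemma cinner_sum_right: "cinner x (\<Sum>i\<in>I. f i) = (\<Sum>i\<in>I. cinner x (f i :: 'a::complex_inner))"
  by (induction I rule: infinite_finite_induct) (simp_all add: cinner_add_right)

lemma cinner_self: "cinner x x = complex_of_real ((norm (x::'a::complex_inner))\<^sup>2)"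
proof -
  have "Im (cinner x x) = 0"
    using arg_cong[OF cinner_commute[of x x], of Im] by simp
  then show ?thesis
    by (simp add: complex_eq_iff norm_eq_sqrt_cinner cinner_ge_zero)
qed

lemma Re_cinner_self: "Re (cinner x x) = (norm (x::'a::complex_inner))\<^sup>2"
  by (simp add: cinner_self)

lemma Re_cinner_commute: "Re (cinner y x) = Re (cinner x (y::'a::complex_inner))"
  using arg_cong[OF cinner_commute[of x y], of Re] by simp

text \<open>Sesquilinearity gives the claim for squares, because the squared norm is
  \<open>cinner x x\<close>.\<close>

lemma norm_scaleC: "norm (c *\<^sub>C (x::'a::complex_inner)) = cmod c * norm x"
proof -
  have "complex_of_real ((norm (c *\<^sub>C x))\<^sup>2) = (cnj c * c) * complex_of_real ((norm x)\<^sup>2)"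
    by (simp only: cinner_self[symmetric]) (simp add: cinner_simps)
  also have "\<dots> = complex_of_real ((cmod c * norm x)\<^sup>2)"
    by (simp only: power_mult_distrib of_real_mult complex_norm_square mult.commute[of "cnj c"])
  finally have "(norm (c *\<^sub>C x))\<^sup>2 = (cmod c * norm x)\<^sup>2"
    using of_real_eq_iff by blast
  then show ?thesis by (simp add: power2_eq_iff_nonneg)
qed

lemma cinner_eqI: "(\<And>z. cinner z x = cinner z y) \<Longrightarrow> x = (y::'a::complex_inner)"
  using cinner_eq_zero_iff[of "x - y"] by (simp add: cinner_diff_right)

subsection \<open>Bounded and positive operators\<close>

lemma bop_bounded_linear:
  assumes "bop T"
  shows "bounded_linear T"
proof -
  obtain K where "\<And>x. norm (T x) \<le> K * norm x" using assms unfolding bop_def by blast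
  then show ?thesis
    using assms unfolding bop_def
    by (intro bounded_linear_intro[of T K]) (auto simp: scaleR_scaleC mult.commute)
qed

lemma bop_add_arg: "bop T \<Longrightarrow> T (x + y) = T x + T y"
  and bop_scaleC_arg: "bop T \<Longrightarrow> T (c *\<^sub>C x) = c *\<^sub>C T x"
  by (auto simp: bop_def)

lemma bop_diff_arg: "bop T \<Longrightarrow> T (x - y) = T x - T y"
  by (simp add: bop_bounded_linear bounded_linear.linear linear_diff)

lemma bop_pos_bound: "bop T \<Longrightarrow> \<exists>K>0. \<forall>x. norm (T x) \<le> K * norm x"
  using bounded_linear.pos_bounded[OF bop_bounded_linear, of T] by (auto simp: mult.commute)

text \<open>Separates real bounded linearity, which has ready closure rules, from compatibility with
  complex scalars.\<close>

lemma bop_iff: "bop T \<longleftrightarrow> bounded_linear T \<and> (\<forall>c x. T (c *\<^sub>C x) = c *\<^sub>C T x)"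
proof
  assume "bop T"
  then show "bounded_linear T \<and> (\<forall>c x. T (c *\<^sub>C x) = c *\<^sub>C T x)"
    using bop_bounded_linear bop_scaleC_arg by blast
next
  assume T: "bounded_linear T \<and> (\<forall>c x. T (c *\<^sub>C x) = c *\<^sub>C T x)"
  then obtain K where "\<And>x. norm (T x) \<le> norm x * K"
    using bounded_linear.bounded[of T] by blast
  then have "\<forall>x. norm (T x) \<le> K * norm x"
    by (simp add: mult.commute)
  with T show "bop T"
    unfolding bop_def by (metis bounded_linear.linear linear_add)
qed

section \<open>Closure properties of B(H)\<close>

lemma bop_id [simp]: "bop id" "bop (\<lambda>x. x)"
  by (auto simp: bop_iff id_def)

lemma bop_zero [simp]: "bop (\<lambda>x. 0)"
  by (auto simp: bop_iff)

lemma bop_add: "bop S \<Longrightarrow> bop T \<Longrightarrow> bop (\<lambda>x. S x + T x)"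
  by (auto simp: bop_iff bounded_linear_add scaleC_add_right)

lemma bop_scaleC: "bop T \<Longrightarrow> bop (\<lambda>x. c *\<^sub>C T x)"
proof -
  assume T: "bop T"
  then obtain K where K: "\<And>x. norm (T x) \<le> K * norm x" using bop_pos_bound by blast
  have "norm (c *\<^sub>C T x) \<le> (cmod c * K) * norm x" for x
    using mult_left_mono[OF K, of "cmod c"] by (simp add: norm_scaleC mult.assoc)
  then show ?thesis
    unfolding bop_def by (auto simp: bop_add_arg[OF T] bop_scaleC_arg[OF T] scaleC_add_right
        scaleC_scaleC mult.commute intro!: exI[of _ "cmod c * K"])
qed

lemma bop_scaleR: "bop T \<Longrightarrow> bop (\<lambda>x. r *\<^sub>R T x)"
  using bop_scaleC[of T "complex_of_real r"] by (simp add: scaleR_scaleC)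

lemma bop_diff: "bop S \<Longrightarrow> bop T \<Longrightarrow> bop (\<lambda>x. S x - T x)"
  using bop_add[of S "\<lambda>x. (- 1) *\<^sub>C T x"] bop_scaleC[of T "- 1"] by (simp add: scaleC_minus_one)

lemma bop_comp: "bop S \<Longrightarrow> bop T \<Longrightarrow> bop (S \<circ> T)"
  using bounded_linear_compose[of S T] by (auto simp: bop_iff comp_def)

lemma bop_sum: "(\<And>i. i \<in> I \<Longrightarrow> bop (f i)) \<Longrightarrow> bop (\<lambda>x. \<Sum>i\<in>I. f i x)"
  by (induction I rule: infinite_finite_induct) (auto intro: bop_add)

text \<open>Hermiticity is automatic, by polarization over the complex field.\<close>

lemma pos_op_hermitian:
  assumes "pos_op T"
  shows "cinner (T x) y = cinner x (T y)"
proof -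
  have T: "bop T" and im: "\<And>x. Im (cinner x (T x)) = 0"
    using assms by (auto simp: pos_op_def cnonneg_def)
  have "Im (cinner x (T y)) = - Im (cinner y (T x))"
    using im[of "x + y"] im[of x] im[of y]
    by (simp add: bop_add_arg[OF T] cinner_simps)
  \<comment> \<open>Multiplying \<open>y\<close> by \<i> turns the identity of imaginary parts into
    one of real parts.\<close>
  moreover have "Re (cinner x (T y)) = Re (cinner y (T x))"
    using im[of "x + \<i> *\<^sub>C y"] im[of x] im[of y]
    by (simp add: bop_add_arg[OF T] bop_scaleC_arg[OF T] cinner_simps)
  ultimately have "cinner x (T y) = cnj (cinner y (T x))"
    by (simp add: complex_eq_iff)
  then show ?thesis
    using cinner_commute[of "T x" y] by simp
qed

text \<open>Positivity at \<open>x + c *\<^sub>C y\<close> is a real quadratic inequality in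
  \<open>t\<close>; the factor \<open>cnj z\<close> in \<open>c\<close> absorbs the phase of
  \<open>z\<close>, so only its modulus remains.\<close>

lemma pos_op_Cauchy_Schwarz:
  assumes "pos_op T"
  shows "(cmod (cinner x (T y)))\<^sup>2 \<le> Re (cinner x (T x)) * Re (cinner y (T y))"
proof -
  have T: "bop T" and pos: "\<And>x. 0 \<le> Re (cinner x (T x))"
    using assms by (auto simp: pos_op_def cnonneg_def)
  define z where "z = cinner x (T y)"
  define a where "a = Re (cinner x (T x))"
  define d where "d = Re (cinner y (T y))"
  have yx: "cinner y (T x) = cnj z"
    unfolding z_def using cinner_commute[of y "T x"] pos_op_hermitian[OF assms, of x y] by simp
  have quad: "0 \<le> a - 2 * t * (cmod z)\<^sup>2 + t\<^sup>2 * (cmod z)\<^sup>2 * d" for t :: real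
  proof -
    define c where "c = complex_of_real (- t) * cnj z"
    have "cinner (x + c *\<^sub>C y) (T (x + c *\<^sub>C y))
      = cinner x (T x) + c * z + cnj c * cnj z + (cnj c * c) * cinner y (T y)"
      by (simp add: bop_add_arg[OF T] bop_scaleC_arg[OF T] cinner_simps yx z_def[symmetric]
          algebra_simps)
    moreover have zz: "cnj z * z = complex_of_real ((cmod z)\<^sup>2)"
      "z * cnj z = complex_of_real ((cmod z)\<^sup>2)"
      by (simp_all only: complex_norm_square mult.commute[of "cnj z"])
    have "c * z = complex_of_real (- t * (cmod z)\<^sup>2)"
      "cnj c * cnj z = complex_of_real (- t * (cmod z)\<^sup>2)"
      "cnj c * c = complex_of_real (t\<^sup>2 * (cmod z)\<^sup>2)"
        using zz by (simp_all add: c_def mult.assoc power2_eq_square[of t])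
    ultimately have "Re (cinner (x + c *\<^sub>C y) (T (x + c *\<^sub>C y)))
      = a - 2 * t * (cmod z)\<^sup>2 + t\<^sup>2 * (cmod z)\<^sup>2 * d"
      by (simp add: a_def d_def)
    then show ?thesis using pos by metis
  qed
  have "(cmod z)\<^sup>2 \<le> a * d"
  proof (cases "d = 0")
    case True
    show ?thesis
    proof (rule ccontr)
      assume "\<not> ?thesis"
      then have "(cmod z)\<^sup>2 > 0" using True by simp
      \<comment> \<open>For \<open>d = 0\<close> the bound is affine in \<open>t\<close>; at this
        value it reads \<open>0 \<le> - a - 2\<close>.\<close>
      then show False using quad[of "(a + 1) / (cmod z)\<^sup>2"] pos[of x] True
        by (simp add: a_def[symmetric])
    qed
  next
    case False
    then have d: "d > 0" using pos[of y] by (simp add: d_def)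
    \<comment> \<open>The quadratic attains its minimum at \<open>t = 1 / d\<close>.\<close>
    then show ?thesis using quad[of "1 / d"] by (simp add: field_simps power2_eq_square)
  qed
  then show ?thesis by (simp add: z_def a_def d_def)
qed

section \<open>Cauchy-Schwarz for vectors and continuity of the inner product\<close>

lemma pos_op_id: "pos_op (\<lambda>x. x)" "pos_op id"
  by (simp_all add: pos_op_def cnonneg_def cinner_self)

lemma norm_cinner_le: "norm (cinner x y) \<le> norm x * norm (y::'a::chilbert_space)"
  using pos_op_Cauchy_Schwarz[OF pos_op_id(1), of x y]
  by (simp add: Re_cinner_self power_mult_distrib[symmetric])

lemma bounded_bilinear_cinner: "bounded_bilinear (cinner :: 'a::chilbert_space \<Rightarrow> 'a \<Rightarrow> complex)"
  by (rule bounded_bilinear.intro)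
    (auto simp: cinner_simps scaleR_conv_of_real intro!: exI[of _ 1] norm_cinner_le)

lemmas tendsto_cinner [tendsto_intros] = bounded_bilinear.tendsto[OF bounded_bilinear_cinner]
lemmas continuous_on_cinner [continuous_intros] =
  bounded_bilinear.continuous_on[OF bounded_bilinear_cinner]

lemma Re_cinner_le: "Re (cinner x y) \<le> norm x * norm (y::'a::chilbert_space)"
  using complex_Re_le_cmod[of "cinner x y"] norm_cinner_le[of x y] by linarith

text \<open>Cauchy-Schwarz for the pair \<open>T x\<close>, \<open>x\<close> bounds the fourth power
  of \<open>norm (T x)\<close> by a product of two values of the form, so a bound on the form is a
  norm bound with the same constant.\<close>

lemma pos_op_norm_le:
  assumes T: "pos_op T" and b: "\<And>x. Re (cinner x (T x)) \<le> b * (norm x)\<^sup>2"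
  shows "norm (T x) \<le> b * norm x"
proof (cases "T x = 0")
  case True
  have "0 \<le> b * (norm x)\<^sup>2"
    using b[of x] T unfolding pos_op_def cnonneg_def by (metis order_trans)
  then have "0 \<le> b * norm x"
    by (cases "norm x = 0") (simp_all add: zero_le_mult_iff)
  with True show ?thesis by simp
next
  case False
  have nn: "0 \<le> Re (cinner z (T z))" for z using T by (simp add: pos_op_def cnonneg_def)
  have "(norm (T x))\<^sup>2 * (norm (T x))\<^sup>2 = (cmod (cinner (T x) (T x)))\<^sup>2"
    by (simp add: cinner_self norm_mult power2_eq_square)
  also have "\<dots> \<le> Re (cinner (T x) (T (T x))) * Re (cinner x (T x))"
    by (rule pos_op_Cauchy_Schwarz[OF T])
  also have "\<dots> \<le> (b * (norm (T x))\<^sup>2) * (b * (norm x)\<^sup>2)"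
    by (intro mult_mono b nn) (meson b nn order_trans)
  finally have "(norm (T x))\<^sup>2 * (norm (T x))\<^sup>2 \<le> (norm (T x))\<^sup>2 * (b * norm x)\<^sup>2"
    by (simp add: power_mult_distrib power2_eq_square ac_simps)
  then have *: "(norm (T x))\<^sup>2 \<le> (b * norm x)\<^sup>2"
    by (rule mult_left_le_imp_le) (use False in simp)
  \<comment> \<open>A nonzero \<open>T x\<close> forces \<open>b\<close> to be nonnegative, which
    permits taking square roots in the inequality of squares.\<close>
  have "0 \<le> b * (norm (T x))\<^sup>2"
    using b[of "T x"] nn[of "T x"] by linarith
  then have "0 \<le> b" using False by (simp add: zero_le_mult_iff)
  then show ?thesis using power2_le_imp_le[OF *] by simp
qed

text \<open>The same Cauchy-Schwarz inequality bounds the form below by a multiple of the square of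
  \<open>norm (C x)\<close>, and the bounded inverse bounds \<open>norm x\<close> by a multiple of
  \<open>norm (C x)\<close>.\<close>

lemma pos_op_invertible_bounded_below:
  assumes C: "pos_op C" "invertible_op C"
  shows "\<exists>a>0. \<forall>x. a * (norm x)\<^sup>2 \<le> Re (cinner x (C x))"
proof -
  obtain K where K: "K > 0" "\<And>x. norm (C x) \<le> K * norm x"
    using C(1) bop_pos_bound unfolding pos_op_def by blast
  obtain D where D: "bop D" "D \<circ> C = id"
    using C(2) unfolding invertible_op_def by blast
  obtain L where L: "L > 0" "\<And>x. norm (D x) \<le> L * norm x"
    using bop_pos_bound[OF D(1)] by blast
  have nn: "0 \<le> Re (cinner z (C z))" for z using C by (simp add: pos_op_def cnonneg_def)
  have "1 / (K * L\<^sup>2) * (norm x)\<^sup>2 \<le> Re (cinner x (C x))" for x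
  proof (cases "C x = 0")
    case True
    then have "D (C x) = 0" using L(2)[of "C x"] by simp
    then have "x = 0" using D(2) by (simp add: fun_eq_iff)
    then show ?thesis by simp
  next
    case False
    have "(norm (C x))\<^sup>2 * (norm (C x))\<^sup>2 = (cmod (cinner (C x) (C x)))\<^sup>2"
      by (simp add: cinner_self norm_mult power2_eq_square)
    also have "\<dots> \<le> Re (cinner (C x) (C (C x))) * Re (cinner x (C x))"
      by (rule pos_op_Cauchy_Schwarz[OF C(1)])
    also have "\<dots> \<le> (norm (C x) * (K * norm (C x))) * Re (cinner x (C x))"
      by (intro mult_right_mono nn order_trans[OF Re_cinner_le] mult_left_mono K(2)) simp
    finally have "(norm (C x))\<^sup>2 * (norm (C x))\<^sup>2 \<le> (norm (C x))\<^sup>2 * (K * Re (cinner x (C x)))"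
      by (simp add: power2_eq_square ac_simps)
    then have "(norm (C x))\<^sup>2 \<le> K * Re (cinner x (C x))"
      by (rule mult_left_le_imp_le) (use False in simp)
    moreover have "norm x \<le> L * norm (C x)"
      using L(2)[of "C x"] D(2) by (simp add: fun_eq_iff)
    then have "(norm x)\<^sup>2 \<le> L\<^sup>2 * (norm (C x))\<^sup>2"
      by (metis norm_ge_zero power_mono power_mult_distrib)
    ultimately have "(norm x)\<^sup>2 \<le> L\<^sup>2 * (K * Re (cinner x (C x)))"
      by (meson mult_left_mono order_trans zero_le_power2)
    then show ?thesis using K(1) L(1) by (simp add: field_simps)
  qed
  moreover have "1 / (K * L\<^sup>2) > 0" using K(1) L(1) by simp
  ultimately show ?thesis by blast
qed

text \<open>The parameter \<open>c\<close> lets a caller place the upper constant above a lower one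
  already chosen.\<close>

lemma bop_Re_cinner_le:
  assumes "bop T"
  obtains K where "c \<le> K" "\<And>x. Re (cinner x (T x)) \<le> K * (norm x)\<^sup>2"
proof -
  obtain K where K: "\<And>x. norm (T x) \<le> K * norm x" using bop_pos_bound[OF assms] by blast
  have "Re (cinner x (T x)) \<le> norm x * (max c K * norm x)" for x
    by (intro order_trans[OF Re_cinner_le] mult_left_mono order_trans[OF K] mult_right_mono) simp_all
  then have "Re (cinner x (T x)) \<le> max c K * (norm x)\<^sup>2" for x
    by (simp add: power2_eq_square mult.left_commute)
  then show ?thesis by (intro that[of "max c K"]) simp_all
qed

text \<open>Dividing \<open>C\<close> by an upper bound \<open>K\<close> of its form puts the form
  of \<open>1 - C / K\<close> between 0 and \<open>1 - a / K\<close>, which also bounds its norm.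
  Both the inverse and the square root start from this.\<close>

lemma pos_op_bounded_below_contraction:
  assumes C: "pos_op C" and a: "a > 0" "\<And>x. a * (norm x)\<^sup>2 \<le> Re (cinner x (C x))"
  obtains K r where "0 < K" "0 \<le> r" "r < 1" "pos_op (\<lambda>x. x - (1 / K) *\<^sub>R C x)"
    "\<And>x. norm (x - (1 / K) *\<^sub>R C x) \<le> r * norm x"
proof -
  have bC: "bop C" using C by (simp add: pos_op_def)
  obtain K where aK: "a \<le> K" and le: "\<And>x. Re (cinner x (C x)) \<le> K * (norm x)\<^sup>2"
    using bop_Re_cinner_le[OF bC] by blast
  have K: "0 < K" using a(1) aK by simp
  define A where "A = (\<lambda>x. x - (1 / K) *\<^sub>R C x)"
  have bA: "bop A" unfolding A_def by (intro bop_diff bop_scaleR bC bop_id)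
  have inner_A: "cinner x (A x) = complex_of_real ((norm x)\<^sup>2 - Re (cinner x (C x)) / K)" for x
    using C by (simp add: A_def cinner_simps cinner_self pos_op_def cnonneg_def complex_eq_iff)
  have pA: "pos_op A"
    using bA le K by (simp add: pos_op_def cnonneg_def inner_A field_simps)
  have "Re (cinner x (A x)) \<le> (1 - a / K) * (norm x)\<^sup>2" for x
    using a(2)[of x] K by (simp add: inner_A field_simps)
  with pA have "norm (A x) \<le> (1 - a / K) * norm x" for x
    by (rule pos_op_norm_le)
  with pA show ?thesis
    unfolding A_def using a aK K by (intro that[of K "1 - a / K"]) simp_all
qed

text \<open>Solving \<open>S x = y\<close> amounts to finding the fixed point of
  \<open>x - S x / b + y / b\<close>, a contraction in \<open>x\<close>. The lower bound on the form
  makes the inverse bounded.\<close>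

lemma pos_op_bounded_below_invertible:
  assumes S: "pos_op S" and a: "a > 0" "\<And>x. a * (norm x)\<^sup>2 \<le> Re (cinner x (S x))"
  shows "invertible_op S"
proof -
  have bS: "bop S" using S by (simp add: pos_op_def)
  obtain b r where b: "b > 0" and r: "0 \<le> r" "r < 1"
    and nA: "\<And>x. norm (x - (1 / b) *\<^sub>R S x) \<le> r * norm x"
    using pos_op_bounded_below_contraction[OF S a] by blast
  have ex1: "\<exists>!x. S x = y" for y
  proof -
    define f where "f = (\<lambda>x. x - (1 / b) *\<^sub>R S x + (1 / b) *\<^sub>R y)"
    have "\<exists>!x. f x = x"
    proof (rule banach_fix_type[OF r], intro allI)
      fix x z
      have "f x - f z = (x - z) - (1 / b) *\<^sub>R S (x - z)"
        by (simp add: f_def bop_diff_arg[OF bS] algebra_simps)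
      then show "dist (f x) (f z) \<le> r * dist x z" using nA[of "x - z"] by (simp add: dist_norm)
    qed
    moreover have "f x = x \<longleftrightarrow> S x = y" for x
    proof -
      have "f x = x \<longleftrightarrow> (1 / b) *\<^sub>R (y - S x) = 0"
        by (auto simp: f_def algebra_simps)
      then show ?thesis using b by auto
    qed
    ultimately show ?thesis by simp
  qed
  define T where "T = (\<lambda>y. THE x. S x = y)"
  have ST: "S (T y) = y" for y unfolding T_def by (rule theI'[OF ex1])
  have TS: "T (S x) = x" for x using ST ex1 by metis
  have "norm (T y) \<le> (1 / a) * norm y" for y
  proof (cases "T y = 0")
    case False
    have "a * (norm (T y))\<^sup>2 \<le> norm (T y) * norm (S (T y))"
      using a(2) Re_cinner_le order_trans by blast
    then have "a * norm (T y) \<le> norm y"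
      using False by (simp add: ST power2_eq_square)
    then show ?thesis using a(1) by (simp add: field_simps)
  qed (use a in simp)
  moreover have "T (x + y) = T x + T y" for x y
    using bop_add_arg[OF bS, of "T x" "T y"] ST TS by metis
  moreover have "T (c *\<^sub>C x) = c *\<^sub>C T x" for c x
    using bop_scaleC_arg[OF bS, of c "T x"] ST TS by metis
  ultimately have "bop T" unfolding bop_def by blast
  then show ?thesis
    unfolding invertible_op_def using bS ST TS by (auto simp: fun_eq_iff intro!: exI[of _ T])
qed

text \<open>Symmetry for the complex inner product forces complex homogeneity. This recovers members
  of B(H) from real bounded linear maps, among which the square root is found.\<close>

lemma bop_hermitianI:
  assumes T: "bounded_linear T" "\<And>x y. cinner (T x) y = cinner x (T y)"
  shows "bop T"
proof -
  have "T (c *\<^sub>C x) = c *\<^sub>C T x" for c x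
    by (rule cinner_eqI) (simp add: T(2)[symmetric] cinner_simps)
  then show ?thesis using T(1) by (simp add: bop_iff)
qed

text \<open>With \<open>C = K (1 - A)\<close> and \<open>\<parallel>A\<parallel> < 1\<close>, a fixed point \<open>Y\<close> of the contraction
  \<open>Y \<mapsto> (A + Y\<^sup>2) / 2\<close> satisfies \<open>(1 - Y)\<^sup>2 = 1 - A\<close>.\<close>

lemma pos_op_invertible_sqrt:
  fixes C :: "'a::chilbert_space \<Rightarrow> 'a"
  assumes C: "pos_op C" "invertible_op C"
  obtains B where "invertible_op B" "\<And>x y. cinner (B x) y = cinner x (B y)" "B \<circ> B = C"
proof -
  have bC: "bop C" using C by (simp add: pos_op_def)
  obtain a where a: "a > 0" "\<And>x. a * (norm x)\<^sup>2 \<le> Re (cinner x (C x))"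
    using pos_op_invertible_bounded_below[OF C] by blast
  obtain K r where K: "K > 0" and r: "0 \<le> r" "r < 1"
    and p: "pos_op (\<lambda>x. x - (1 / K) *\<^sub>R C x)"
    and n: "\<And>x. norm (x - (1 / K) *\<^sub>R C x) \<le> r * norm x"
    using pos_op_bounded_below_contraction[OF C(1) a] by blast
  define A where "A = (\<lambda>x. x - (1 / K) *\<^sub>R C x)"
  have pA: "pos_op A" and nA: "\<And>x. norm (A x) \<le> r * norm x" unfolding A_def by (fact p, fact n)
  have bA: "bop A" using pA by (simp add: pos_op_def)
  define A' where "A' = Blinfun A"
  have A': "blinfun_apply A' = A"
    unfolding A'_def by (rule bounded_linear_Blinfun_apply[OF bop_bounded_linear[OF bA]])
  have nA': "norm A' \<le> r" by (rule norm_blinfun_bound[OF r(1)]) (simp add: A' nA)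
  define F :: "('a \<Rightarrow>\<^sub>L 'a) \<Rightarrow> ('a \<Rightarrow>\<^sub>L 'a)" where "F = (\<lambda>Y. (1/2) *\<^sub>R (A' + (Y o\<^sub>L Y)))"
  \<comment> \<open>The ball of radius \<open>r\<close> is preserved because
    \<open>r * r \<le> r\<close>, and on it \<open>F\<close> contracts by \<open>r\<close>; the
    symmetry condition makes the fixed point hermitian.\<close>
  define M :: "('a \<Rightarrow>\<^sub>L 'a) set"
    where "M = {Y. norm Y \<le> r \<and> (\<forall>x y. cinner (blinfun_apply Y x) y = cinner x (blinfun_apply Y y))}"
  have cont: "continuous_on UNIV (\<lambda>Y::'a \<Rightarrow>\<^sub>L 'a. blinfun_apply Y x)" for x
    by (rule linear_continuous_on[OF blinfun.bounded_linear_left])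
  have "closed {Y::'a \<Rightarrow>\<^sub>L 'a. cinner (blinfun_apply Y x) y = cinner x (blinfun_apply Y y)}" for x y
    by (intro closed_Collect_eq continuous_on_cinner continuous_on_const cont)
  moreover have "M = cball 0 r \<inter>
      (\<Inter>x y. {Y. cinner (blinfun_apply Y x) y = cinner x (blinfun_apply Y y)})"
    by (auto simp: M_def)
  ultimately have "closed M"
    by (simp add: closed_Int closed_INT)
  then have "complete M" by (simp add: complete_eq_closed)
  moreover have "0 \<in> M" using r(1) by (simp add: M_def)
  then have "M \<noteq> {}" by blast
  moreover have "F ` M \<subseteq> M"
  proof (rule image_subsetI)
    fix Y assume Y: "Y \<in> M"
    then have "norm (Y o\<^sub>L Y) \<le> r * r"
      by (intro order_trans[OF norm_blinfun_compose] mult_mono) (auto simp: M_def r)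
    also have "\<dots> \<le> r" using r by (simp add: mult_left_le)
    finally have "norm (A' + (Y o\<^sub>L Y)) \<le> 2 * r"
      using nA' norm_triangle_ineq[of A' "Y o\<^sub>L Y"] by linarith
    moreover have "cinner (F Y x) y = cinner x (F Y y)" for x y
      using Y pos_op_hermitian[OF pA]
      by (simp add: M_def F_def A' blinfun.bilinear_simps cinner_simps)
    ultimately show "F Y \<in> M" by (simp add: M_def F_def)
  qed
  moreover have "dist (F Y) (F Z) \<le> r * dist Y Z" if "Y \<in> M" "Z \<in> M" for Y Z
  proof -
    \<comment> \<open>Difference of squares for operators that need not commute.\<close>
    have "F Y - F Z = (1/2) *\<^sub>R ((Y o\<^sub>L (Y - Z)) + ((Y - Z) o\<^sub>L Z))"
      by (rule blinfun_eqI) (simp add: F_def blinfun.bilinear_simps algebra_simps)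
    then have "norm (F Y - F Z) = (1/2) * norm ((Y o\<^sub>L (Y - Z)) + ((Y - Z) o\<^sub>L Z))"
      by simp
    also have "\<dots> \<le> (1/2) * (norm Y * norm (Y - Z) + norm (Y - Z) * norm Z)"
      by (intro mult_left_mono order_trans[OF norm_triangle_ineq] add_mono norm_blinfun_compose)
        simp
    also have "\<dots> \<le> (1/2) * (r * norm (Y - Z) + norm (Y - Z) * r)"
      using that by (intro mult_left_mono add_mono mult_right_mono) (auto simp: M_def)
    finally show ?thesis by (simp add: dist_norm)
  qed
  ultimately obtain Y where Y: "Y \<in> M" "F Y = Y"
    using Banach_fix[of M r F] r by blast
  have fix': "2 *\<^sub>R Y x = A x + Y (Y x)" for x
    using arg_cong[OF Y(2), of "\<lambda>Z. 2 *\<^sub>R blinfun_apply Z x"]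
    by (simp add: F_def blinfun.bilinear_simps A')
  \<comment> \<open>The factor \<open>sqrt K\<close> undoes the normalization
    \<open>A = 1 - C / K\<close>.\<close>
  define B where "B = (\<lambda>x. sqrt K *\<^sub>R (x - Y x))"
  have herm: "cinner (B x) y = cinner x (B y)" for x y
    using Y(1) by (simp add: B_def M_def cinner_simps)
  have "bounded_linear B"
    unfolding B_def by (rule bounded_linear_compose[OF bounded_linear_scaleR_right
          bounded_linear_sub[OF bounded_linear_ident blinfun.bounded_linear_right]])
  then have bB: "bop B" using herm by (rule bop_hermitianI)
  have "B (B x) = C x" for x
  proof -
    have "B (B x) = (sqrt K * sqrt K) *\<^sub>R (x - 2 *\<^sub>R Y x + Y (Y x))"
      by (simp add: B_def blinfun.bilinear_simps algebra_simps scaleR_2)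
    also have "\<dots> = K *\<^sub>R (x - A x)"
      using K by (simp add: fix')
    also have "\<dots> = C x" using K by (simp add: A_def)
    finally show ?thesis .
  qed
  then have BB: "B \<circ> B = C" by auto
  obtain D where D: "bop D" "C \<circ> D = id" "D \<circ> C = id"
    using C(2) unfolding invertible_op_def by blast
  \<comment> \<open>\<open>B\<close> commutes with its square \<open>C\<close>, hence with the
    inverse \<open>D\<close> of \<open>C\<close>; so \<open>B \<circ> D\<close> inverts
    \<open>B\<close> on both sides.\<close>
  have comm: "D \<circ> B = B \<circ> D"
  proof -
    have "D \<circ> B = D \<circ> B \<circ> (C \<circ> D)" using D by simp
    also have "\<dots> = (D \<circ> C) \<circ> B \<circ> D" by (simp add: BB[symmetric] comp_assoc)
    finally show ?thesis using D by simp
  qed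
  have "B \<circ> (B \<circ> D) = id" by (simp add: comp_assoc[symmetric] BB D)
  moreover have "(B \<circ> D) \<circ> B = id"
    using calculation by (simp add: comp_assoc comm)
  ultimately have "invertible_op B"
    unfolding invertible_op_def using bB bop_comp[OF bB D(1)] by blast
  then show ?thesis using herm BB by (rule that)
qed

subsection \<open>Adjoints\<close>

text \<open>The representing vector minimizes \<open>\<parallel>x\<parallel>\<^sup>2 - 2 Re f(x)\<close>; minimizing sequences are Cauchy
  by the parallelogram identity.\<close>

lemma Riesz_representation:
  fixes f :: "'a::chilbert_space \<Rightarrow> complex"
  assumes f: "bounded_linear f" "\<And>c x. f (c *\<^sub>C x) = c * f x"
  shows "\<exists>u. \<forall>x. f x = cinner u x"
proof -
  interpret f: bounded_linear f by fact
  obtain K where K: "\<And>x. cmod (f x) \<le> norm x * K" using f.bounded by blast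
  define J where "J = (\<lambda>x. (norm x)\<^sup>2 - 2 * Re (f x))"
  have J_bound: "- K\<^sup>2 \<le> J x" for x
  proof -
    have "Re (f x) \<le> norm x * K" using K[of x] complex_Re_le_cmod[of "f x"] by linarith
    moreover have "0 \<le> (norm x - K)\<^sup>2" by simp
    ultimately show ?thesis by (simp add: J_def power2_diff)
  qed
  define m where "m = Inf (range J)"
  have bdd: "bdd_below (range J)" using J_bound by (intro bdd_belowI[of _ "- K\<^sup>2"]) auto
  have m_le: "m \<le> J x" for x unfolding m_def by (rule cInf_lower[OF _ bdd]) simp
  have "\<exists>x. J x < m + e" if "e > 0" for e
    using cInf_lessD[of "range J" "m + e"] that by (auto simp: m_def)
  then have "\<forall>n. \<exists>x. J x < m + 1 / real (Suc n)" by simp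
  then obtain X where X: "J (X n) < m + 1 / real (Suc n)" for n by metis
  have para: "(norm (x - y))\<^sup>2 \<le> 2 * J x + 2 * J y - 4 * m" for x y
  proof -
    have "(norm (x - y))\<^sup>2 = 2 * J x + 2 * J y - 4 * J ((1/2) *\<^sub>R (x + y))"
      by (simp add: J_def Re_cinner_self[symmetric] f.scaleR f.add cinner_simps algebra_simps
          Re_cinner_commute[of y x])
    then show ?thesis using m_le[of "(1/2) *\<^sub>R (x + y)"] by linarith
  qed
  have "Cauchy X"
  proof (rule metric_CauchyI)
    fix e :: real assume e: "e > 0"
    obtain N where N: "1 / real (Suc N) < e\<^sup>2 / 4"
      using e nat_approx_posE[of "e\<^sup>2 / 4"] by auto
    have "dist (X i) (X j) < e" if "i \<ge> N" "j \<ge> N" for i j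
    proof -
      have "1 / real (Suc i) \<le> 1 / real (Suc N)" "1 / real (Suc j) \<le> 1 / real (Suc N)"
        using that by (simp_all add: frac_le)
      then have "(norm (X i - X j))\<^sup>2 < e\<^sup>2"
        using para[of "X i" "X j"] X[of i] X[of j] N by linarith
      then show ?thesis using e by (simp add: dist_norm power_less_imp_less_base)
    qed
    then show "\<exists>N. \<forall>i\<ge>N. \<forall>j\<ge>N. dist (X i) (X j) < e" by blast
  qed
  then obtain u where u: "X \<longlonglongrightarrow> u" using Cauchy_convergent convergent_def by blast
  have "(\<lambda>n. J (X n)) \<longlonglongrightarrow> J u"
    unfolding J_def by (intro tendsto_intros u f.tendsto)
  moreover have "(\<lambda>n. m + 1 / real (Suc n)) \<longlonglongrightarrow> m + 0"
    by (intro tendsto_add tendsto_const) (use LIMSEQ_inverse_real_of_nat in \<open>simp add: field_simps\<close>)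
  ultimately have "J u \<le> m + 0"
    by (rule LIMSEQ_le) (use X less_imp_le in blast)
  then have J_min: "J u \<le> J x" for x using m_le[of x] by simp
  \<comment> \<open>First variation: if the derivative \<open>2 * d\<close> of \<open>J\<close> at
    \<open>u\<close> in direction \<open>x\<close> were nonzero, a small step against it would go
    below the minimum.\<close>
  have re: "Re (f x) = Re (cinner u x)" for x
  proof (rule ccontr)
    define d where "d = Re (cinner u x) - Re (f x)"
    assume "Re (f x) \<noteq> Re (cinner u x)"
    then have d: "d \<noteq> 0" by (simp add: d_def)
    have ineq: "0 \<le> 2 * t * d + t\<^sup>2 * (norm x)\<^sup>2" for t
    proof -
      have "(norm (u + t *\<^sub>R x))\<^sup>2
        = (norm u)\<^sup>2 + 2 * t * Re (cinner u x) + t * (t * (norm x)\<^sup>2)"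
        by (simp add: Re_cinner_self[symmetric] cinner_simps Re_cinner_commute[of x u]
            algebra_simps)
      then have "J (u + t *\<^sub>R x) = J u + 2 * t * d + t\<^sup>2 * (norm x)\<^sup>2"
        by (simp add: J_def d_def f.scaleR f.add power2_eq_square[of t] algebra_simps)
      then show ?thesis using J_min[of "u + t *\<^sub>R x"] by linarith
    qed
    \<comment> \<open>Adding 1 keeps the step size \<open>- d / N\<close> defined when
      \<open>x = 0\<close> and the estimate strict.\<close>
    define N where "N = (norm x)\<^sup>2 + 1"
    have N: "N > 0" "(norm x)\<^sup>2 < N" by (simp_all add: N_def add_nonneg_pos)
    have "0 \<le> - 2 * d\<^sup>2 / N + d\<^sup>2 / N\<^sup>2 * (norm x)\<^sup>2"
      using ineq[of "- d / N"] by (simp add: power2_eq_square)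
    also have "\<dots> \<le> - 2 * d\<^sup>2 / N + d\<^sup>2 / N\<^sup>2 * N"
      using N by (intro add_left_mono mult_left_mono) simp_all
    also have "\<dots> = - d\<^sup>2 / N" using N by (simp add: power2_eq_square)
    also have "\<dots> < 0" using d N by simp
    finally show False by simp
  qed
  \<comment> \<open>The real parts at \<i> times \<open>x\<close> are the negated imaginary parts at
    \<open>x\<close>.\<close>
  have "f x = cinner u x" for x
    using re[of x] re[of "\<i> *\<^sub>C x"] by (simp add: f(2) cinner_simps complex_eq_iff)
  then show ?thesis by blast
qed

text \<open>Discharges the definite description in \<open>adj\<close>: vectors with equal inner
  products coincide, so at most one such \<open>S\<close> exists.\<close>

lemma adj_eqI: "(\<And>x y. cinner (T x) y = cinner x (S y)) \<Longrightarrow> adj T = S"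
  unfolding adj_def by (rule the_equality) (simp, metis cinner_eqI ext)

text \<open>Existence of the adjoint: Riesz representation of the functionals
  \<open>cinner y (T x)\<close> of \<open>x\<close> supplies \<open>S y\<close>, and linearity and
  boundedness of \<open>S\<close> follow from the adjoint identity.\<close>

lemma
  assumes T: "bop T"
  shows cinner_adj: "cinner (T x) y = cinner x (adj T y)"
    and bop_adj: "bop (adj T)"
proof -
  have "\<exists>u. \<forall>x. cinner y (T x) = cinner u x" for y
    by (rule Riesz_representation)
      (auto simp: bop_scaleC_arg[OF T] cinner_scaleC_right
        intro!: bounded_linear_compose[OF bounded_bilinear.bounded_linear_right
            [OF bounded_bilinear_cinner]] bop_bounded_linear[OF T])
  then obtain S where S: "\<And>x y. cinner y (T x) = cinner (S y) x" by metis
  have S': "cinner (T x) y = cinner x (S y)" for x y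
    using S[of y x] cinner_commute by metis
  then have eq: "adj T = S" by (rule adj_eqI)
  obtain K where K: "K > 0" "\<And>x. norm (T x) \<le> K * norm x" using bop_pos_bound[OF T] by blast
  have "S (x + y) = S x + S y" "S (c *\<^sub>C x) = c *\<^sub>C S x" for x y c
    by (rule cinner_eqI, simp add: S'[symmetric] cinner_simps)+
  moreover have "norm (S y) \<le> K * norm y" for y
  proof (cases "S y = 0")
    case False
    have "(norm (S y))\<^sup>2 = Re (cinner y (T (S y)))" by (simp add: S Re_cinner_self)
    also have "\<dots> \<le> norm y * (K * norm (S y))"
      by (intro order_trans[OF Re_cinner_le] mult_left_mono K(2)) simp
    finally have "norm (S y) * norm (S y) \<le> norm (S y) * (K * norm y)"
      by (simp add: power2_eq_square ac_simps)
    then show ?thesis using False by simp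
  qed (use K in simp)
  ultimately show "cinner (T x) y = cinner x (adj T y)" "bop (adj T)"
    unfolding eq bop_def using S' by blast+
qed

lemma cinner_adj_right:
  assumes "bop T"
  shows "cinner x (T y) = cinner (adj T x) y"
  using cinner_adj[OF assms, of y x] cinner_commute by metis

section \<open>Invertible operators under composition and adjoints\<close>

lemma invertible_op_comp:
  assumes "invertible_op S" "invertible_op T"
  shows "invertible_op (S \<circ> T)"
proof -
  obtain S' T' where "bop S'" "S \<circ> S' = id" "S' \<circ> S = id" "bop T'" "T \<circ> T' = id" "T' \<circ> T = id"
    using assms unfolding invertible_op_def by blast
  moreover from this have "(S \<circ> T) \<circ> (T' \<circ> S') = id" "(T' \<circ> S') \<circ> (S \<circ> T) = id"
    by (simp_all add: fun_eq_iff)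
  ultimately show ?thesis
    using assms unfolding invertible_op_def by (meson bop_comp)
qed

lemma invertible_op_adj:
  assumes "invertible_op R"
  shows "invertible_op (adj R)"
proof -
  obtain S where R: "bop R" and S: "bop S" "\<And>x. R (S x) = x" "\<And>x. S (R x) = x"
    using assms unfolding invertible_op_def by (auto simp: fun_eq_iff)
  have "adj R (adj S x) = x" "adj S (adj R x) = x" for x
    by (rule cinner_eqI,
        simp add: cinner_adj[OF R, symmetric] cinner_adj[OF S(1), symmetric] S)+
  then show ?thesis
    unfolding invertible_op_def using bop_adj[OF R] bop_adj[OF S(1)]
    by (auto simp: fun_eq_iff intro!: exI[of _ "adj S"])
qed

subsection \<open>Completely positive maps\<close>

lemma linear_map_BH_bop: "linear_map_BH \<phi> \<Longrightarrow> bop X \<Longrightarrow> bop (\<phi> X)"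
  and linear_map_BH_add: "linear_map_BH \<phi> \<Longrightarrow> bop X \<Longrightarrow> bop Y \<Longrightarrow>
    \<phi> (\<lambda>x. X x + Y x) = (\<lambda>x. \<phi> X x + \<phi> Y x)"
  and linear_map_BH_scaleC: "linear_map_BH \<phi> \<Longrightarrow> bop X \<Longrightarrow>
    \<phi> (\<lambda>x. c *\<^sub>C X x) = (\<lambda>x. c *\<^sub>C \<phi> X x)"
  by (auto simp: linear_map_BH_def)

lemma linear_map_BH_diff:
  assumes "linear_map_BH \<phi>" "bop X" "bop Y"
  shows "\<phi> (\<lambda>x. X x - Y x) = (\<lambda>x. \<phi> X x - \<phi> Y x)"
  using linear_map_BH_add[OF assms(1,2) bop_scaleC[OF assms(3), of "- 1"]]
    linear_map_BH_scaleC[OF assms(1,3), of "- 1"]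
  by (simp add: scaleC_minus_one)

lemma linear_map_BH_zero:
  assumes "linear_map_BH \<phi>"
  shows "\<phi> (\<lambda>x. 0) = (\<lambda>x. 0)"
  using linear_map_BH_diff[OF assms, of "\<lambda>x. x" "\<lambda>x. x"] by simp

lemma linear_map_BH_sum:
  assumes "linear_map_BH \<phi>" "\<And>i. i \<in> I \<Longrightarrow> bop (f i)"
  shows "\<phi> (\<lambda>x. \<Sum>i\<in>I. f i x) = (\<lambda>x. \<Sum>i\<in>I. \<phi> (f i) x)"
  using assms(2)
proof (induction I rule: infinite_finite_induct)
  case (insert i I)
  then show ?case
    using linear_map_BH_add[OF assms(1), of "f i" "\<lambda>x. \<Sum>i\<in>I. f i x"] by (simp add: bop_sum)
qed (simp_all add: linear_map_BH_zero[OF assms(1)])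

lemma linear_map_BH_funpow: "linear_map_BH \<phi> \<Longrightarrow> linear_map_BH (\<phi> ^^ n)"
  by (induction n) (auto simp: linear_map_BH_def)

text \<open>By linearity of the powers each summand is a difference of consecutive iterates of
  \<open>C\<close>.\<close>

lemma sum_funpow_telescope:
  assumes \<phi>: "linear_map_BH \<phi>" and C: "bop C"
  shows "(\<Sum>k<n. (\<phi> ^^ k) (\<lambda>x. C x - \<phi> C x) x) = C x - (\<phi> ^^ n) C x"
proof (induction n)
  case (Suc n)
  have "(\<phi> ^^ n) (\<lambda>x. C x - \<phi> C x) = (\<lambda>x. (\<phi> ^^ n) C x - (\<phi> ^^ Suc n) C x)"
    using linear_map_BH_diff[OF linear_map_BH_funpow[OF \<phi>] C linear_map_BH_bop[OF \<phi> C], of n]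
    by (simp only: funpow_Suc_right comp_apply)
  with Suc show ?case by simp
qed simp

section \<open>Complete positivity: powers, compositions and conjugations\<close>

lemma completely_positive_linear: "completely_positive \<phi> \<Longrightarrow> linear_map_BH \<phi>"
  by (simp add: completely_positive_def)

lemma pos_opmatrix_1: "pos_opmatrix (Suc 0) X \<longleftrightarrow> pos_op (X 0 0)"
  unfolding pos_opmatrix_def pos_op_def by (auto dest: spec[of _ "\<lambda>_. _"])

lemma completely_positive_pos_op: "completely_positive \<phi> \<Longrightarrow> pos_op X \<Longrightarrow> pos_op (\<phi> X)"
  unfolding completely_positive_def using pos_opmatrix_1[of "\<lambda>i j. X"] pos_opmatrix_1[of "\<lambda>i j. \<phi> X"]
  by auto

lemma completely_positive_funpow_pos_op:
  "completely_positive \<phi> \<Longrightarrow> pos_op X \<Longrightarrow> pos_op ((\<phi> ^^ n) X)"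
  by (induction n) (simp_all add: completely_positive_pos_op)

lemma completely_positive_comp:
  "completely_positive \<phi> \<Longrightarrow> completely_positive \<psi> \<Longrightarrow> completely_positive (\<phi> \<circ> \<psi>)"
  by (auto simp: completely_positive_def linear_map_BH_def)

text \<open>Conjugation only replaces the test vectors \<open>v i\<close> by \<open>S (v i)\<close>.
  The adjoint relation is a hypothesis, so that symmetric operators can be inserted
  directly.\<close>

lemma completely_positive_conjugation:
  assumes S: "bop S" and T: "bop T" and ST: "\<And>x y. cinner (S x) y = cinner x (T y)"
  shows "completely_positive (\<lambda>X. T \<circ> X \<circ> S)"
  unfolding completely_positive_def
proof (intro conjI allI impI)
  show "linear_map_BH (\<lambda>X. T \<circ> X \<circ> S)"
    unfolding linear_map_BH_def
    by (auto intro!: bop_comp S T simp: fun_eq_iff bop_add_arg[OF T] bop_scaleC_arg[OF T])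
  fix n and X :: "nat \<Rightarrow> nat \<Rightarrow> 'a \<Rightarrow> 'a"
  assume X: "pos_opmatrix n X"
  have "cnonneg (\<Sum>i<n. \<Sum>j<n. cinner (v i) ((T \<circ> X i j \<circ> S) (v j)))" for v :: "nat \<Rightarrow> 'a"
    using X unfolding pos_opmatrix_def by (auto simp: ST[symmetric] dest: spec[of _ "\<lambda>i. S (v i)"])
  with X show "pos_opmatrix n (\<lambda>i j. T \<circ> X i j \<circ> S)"
    unfolding pos_opmatrix_def by (auto intro!: bop_comp S T)
qed

text \<open>A bound \<open>\<parallel>X\<parallel> \<le> M\<close> makes the block matrix with rows \<open>(M, X)\<close>, \<open>(X\<^sup>*, M)\<close> positive, and
  two-positivity transports this to \<open>\<psi> X\<close>.\<close>

lemma completely_positive_norm_le_one: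
  fixes \<psi> :: "('a::chilbert_space \<Rightarrow> 'a) \<Rightarrow> ('a \<Rightarrow> 'a)"
  assumes \<psi>: "completely_positive \<psi>" and le: "\<And>x. Re (cinner x (\<psi> id x)) \<le> (norm x)\<^sup>2"
  shows "map_norm_le_one \<psi>"
  unfolding map_norm_le_one_def
proof (intro allI impI)
  fix X :: "'a \<Rightarrow> 'a" assume X: "bop X"
  note lin = completely_positive_linear[OF \<psi>]
  define M where "M = onorm X"
  have M: "0 \<le> M" unfolding M_def by (rule onorm_pos_le[OF bop_bounded_linear[OF X]])
  have nX: "norm (X x) \<le> M * norm x" for x
    unfolding M_def by (rule onorm[OF bop_bounded_linear[OF X]])
  define E where "E = (\<lambda>i j::nat. if i = j then (\<lambda>x. complex_of_real M *\<^sub>C id x)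
    else if i = 0 then X else adj X)"
  have "pos_opmatrix 2 E"
    unfolding pos_opmatrix_def
  proof (intro conjI allI impI)
    show "bop (E i j)" for i j
      using X bop_adj[OF X] bop_scaleC[OF bop_id(1)] by (auto simp: E_def)
    fix v :: "nat \<Rightarrow> 'a"
    \<comment> \<open>The cross term is dominated through the square of
      \<open>norm (v 0) - norm (v 1)\<close>, weighted by \<open>M\<close>.\<close>
    have "- Re (cinner (v 0) (X (v 1))) \<le> norm (v 0) * (M * norm (v 1))"
    proof -
      have "- Re (cinner (v 0) (X (v 1))) \<le> cmod (cinner (v 0) (X (v 1)))"
        using abs_Re_le_cmod[of "cinner (v 0) (X (v 1))"] by linarith
      also have "\<dots> \<le> norm (v 0) * (M * norm (v 1))"
        by (rule order_trans[OF norm_cinner_le mult_left_mono[OF nX norm_ge_zero]])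
      finally show ?thesis .
    qed
    moreover have "0 \<le> M * (norm (v 0) - norm (v 1))\<^sup>2" using M by simp
    ultimately have "0 \<le> M * (norm (v 0))\<^sup>2 + M * (norm (v 1))\<^sup>2 + 2 * Re (cinner (v 0) (X (v 1)))"
      by (simp add: power2_diff algebra_simps)
    moreover have "cinner (v 1) (adj X (v 0)) = cnj (cinner (v 0) (X (v 1)))"
      using cinner_adj[OF X, of "v 1" "v 0"] cinner_commute by metis
    then have "(\<Sum>i<2. \<Sum>j<2. cinner (v i) (E i j (v j)))
      = complex_of_real (M * (norm (v 0))\<^sup>2 + M * (norm (v 1))\<^sup>2 + 2 * Re (cinner (v 0) (X (v 1))))"
      by (simp add: numeral_2_eq_2 E_def cinner_simps cinner_self complex_eq_iff)
    ultimately show "cnonneg (\<Sum>i<2. \<Sum>j<2. cinner (v i) (E i j (v j)))"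
      by (simp only: cnonneg_def Re_complex_of_real Im_complex_of_real)
  qed
  then have "pos_opmatrix 2 (\<lambda>i j. \<psi> (E i j))"
    using \<psi> by (simp add: completely_positive_def)
  then have "cnonneg (\<Sum>i<2. \<Sum>j<2. cinner (v i) (\<psi> (E i j) (v j)))" for v
    unfolding pos_opmatrix_def by blast
  from this[of "\<lambda>i. if i = 0 then _ else _"]
  have cn: "cnonneg (M * cinner p (\<psi> id p) + cinner p (\<psi> X q)
      + (cinner q (\<psi> (adj X) p) + M * cinner q (\<psi> id q)))" for p q
    using linear_map_BH_scaleC[OF lin bop_id(1), of "complex_of_real M"]
    by (simp add: numeral_2_eq_2 E_def cinner_scaleC_right)
  have im: "Im (cinner p (\<psi> id p)) = 0" for p
    using completely_positive_pos_op[OF \<psi> pos_op_id(2)] by (simp add: pos_op_def cnonneg_def)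
  note bX' = linear_map_BH_bop[OF lin bop_adj[OF X]]
    and bI = linear_map_BH_bop[OF lin bop_id(1)]
  have "norm (\<psi> X q) \<le> M * norm q" for q
  proof -
    define u where "u = \<psi> X q"
    \<comment> \<open>The matrix form is real also at \<i> times \<open>p\<close>; its vanishing
      imaginary part equates the real parts of the two off-diagonal terms.\<close>
    have "Re (cinner q (\<psi> (adj X) p)) = Re (cinner p (\<psi> X q))" for p
      using cn[of "\<i> *\<^sub>C p" q] im
      by (simp add: cnonneg_def cinner_simps bop_scaleC_arg[OF bX'] bop_scaleC_arg[OF bI])
    then have "0 \<le> M * Re (cinner p (\<psi> id p)) + 2 * Re (cinner p u) + M * Re (cinner q (\<psi> id q))"
      for p
      using cn[of p q] by (simp add: cnonneg_def u_def)
    moreover have "M * Re (cinner p (\<psi> id p)) \<le> M * (norm p)\<^sup>2" for p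
      using le M by (rule mult_left_mono)
    ultimately have main: "0 \<le> M * (norm p)\<^sup>2 + 2 * Re (cinner p u) + M * (norm q)\<^sup>2" for p
      by (smt (verit))
    show ?thesis
    proof (cases "M = 0")
      case True
      then show ?thesis using main[of "- u"] by (simp add: cinner_minus_left Re_cinner_self u_def)
    next
      case False
      with M have M: "M > 0" by simp
      have "0 \<le> M * ((norm u)\<^sup>2 / M\<^sup>2) - 2 * ((norm u)\<^sup>2 / M) + M * (norm q)\<^sup>2"
        \<comment> \<open>This \<open>p\<close> minimizes the left-hand quadratic; for
          \<open>M = 0\<close> above, any negative multiple of \<open>u\<close> would do.\<close>
        using main[of "(- 1 / M) *\<^sub>R u"] M
        by (simp add: cinner_simps Re_cinner_self power_divide)
      then have "(norm u)\<^sup>2 \<le> (M * norm q)\<^sup>2"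
        using M by (simp add: field_simps power2_eq_square)
      then show ?thesis unfolding u_def[symmetric] by (rule power2_le_imp_le) (use M in simp)
    qed
  qed
  then show "onorm (\<psi> X) \<le> onorm X"
    unfolding M_def[symmetric] using M by (intro onorm_bound)
qed

subsection \<open>The weak* topology\<close>

text \<open>The open sets are the traces on \<open>A\<close> of preimages of open sets, so
  neighbourhoods of \<open>l\<close> come from those of \<open>f l\<close>.\<close>

lemma limitin_pullback_topology:
  "limitin (pullback_topology A f T) X l F \<longleftrightarrow>
    l \<in> A \<and> eventually (\<lambda>n. X n \<in> A) F \<and> limitin T (\<lambda>n. f (X n)) (f l) F"
proof
  assume L: "limitin (pullback_topology A f T) X l F"
  then have l: "l \<in> A" "f l \<in> topspace T"
    by (auto simp: limitin_def topspace_pullback_topology)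
  have ev: "eventually (\<lambda>n. X n \<in> f -` U \<inter> A) F" if "openin T U" "f l \<in> U" for U
    using L that l(1) unfolding limitin_def openin_pullback_topology by blast
  from ev[of "topspace T"] l have "eventually (\<lambda>n. X n \<in> A) F"
    by (simp add: eventually_conj_iff)
  moreover have "limitin T (\<lambda>n. f (X n)) (f l) F"
    unfolding limitin_def using l(2) ev by (auto elim!: eventually_mono[OF ev])
  ultimately show "l \<in> A \<and> eventually (\<lambda>n. X n \<in> A) F \<and> limitin T (\<lambda>n. f (X n)) (f l) F"
    using l by blast
next
  assume "l \<in> A \<and> eventually (\<lambda>n. X n \<in> A) F \<and> limitin T (\<lambda>n. f (X n)) (f l) F"
  then show "limitin (pullback_topology A f T) X l F"
    unfolding limitin_def openin_pullback_topology topspace_pullback_topology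
    by (auto intro!: eventually_conj)
qed

lemma limitin_wstar_iff:
  "limitin wstar_topology X L F \<longleftrightarrow> bop L \<and> eventually (\<lambda>n. bop (X n)) F \<and>
    (\<forall>\<omega>\<in>normal_index. ((\<lambda>n. normal_functional \<omega> (X n)) \<longlongrightarrow> normal_functional \<omega> L) F)"
  by (simp add: wstar_topology_def limitin_pullback_topology limitin_componentwise)

text \<open>Matrix coefficients are normal functionals: take sequences supported at index 0.\<close>

lemma limitin_wstar_cinner:
  assumes "limitin wstar_topology X L F"
  shows "((\<lambda>n. cinner x (X n y)) \<longlongrightarrow> cinner x (L y)) F"
proof -
  define \<omega> where "\<omega> = (\<lambda>k::nat. if k = 0 then x else 0, \<lambda>k::nat. if k = 0 then y else 0)"
  have "\<omega> \<in> normal_index"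
    by (auto simp: \<omega>_def normal_index_def intro!: summable_finite[of "{0}"] split: if_splits)
  moreover have "normal_functional \<omega> T = cinner x (T y)" for T
  proof -
    have "normal_functional \<omega> T = (\<Sum>k\<in>{0}. cinner (fst \<omega> k) (T (snd \<omega> k)))"
      unfolding normal_functional_def by (rule suminf_finite) (auto simp: \<omega>_def)
    then show ?thesis by (simp add: \<omega>_def)
  qed
  ultimately show ?thesis
    using assms unfolding limitin_wstar_iff by (auto dest: bspec[of _ _ \<omega>])
qed

text \<open>Dominated convergence for series: strong convergence gives the limit of each term, and
  the uniform bound gives a summable majorant independent of \<open>n\<close>.\<close>

lemma bounded_strong_limit_imp_limitin_wstar:
  assumes X: "\<And>n. bop (X n)" "\<And>n x. norm (X n x) \<le> K * norm x"
    and L: "bop L" "\<And>x. (\<lambda>n. X n x) \<longlonglongrightarrow> L x"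
  shows "limitin wstar_topology X L sequentially"
  unfolding limitin_wstar_iff
proof (intro conjI ballI)
  fix \<omega> :: "(nat \<Rightarrow> 'a) \<times> (nat \<Rightarrow> 'a)"
  assume "\<omega> \<in> normal_index"
  then obtain u v where \<omega>: "\<omega> = (u, v)" "summable (\<lambda>k. (norm (u k))\<^sup>2)" "summable (\<lambda>k. (norm (v k))\<^sup>2)"
    by (cases \<omega>) (auto simp: normal_index_def)
  \<comment> \<open>The absolute value makes the majorant nonnegative for either sign of
    \<open>K\<close>.\<close>
  define M where "M = (\<lambda>k. \<bar>K\<bar> * ((norm (u k))\<^sup>2 + (norm (v k))\<^sup>2))"
  have "summable M" unfolding M_def by (intro summable_mult summable_add \<omega>)
  moreover have "norm (cinner (u k) (X n (v k))) \<le> M k" for k n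
  proof -
    have "norm (cinner (u k) (X n (v k))) \<le> norm (u k) * (\<bar>K\<bar> * norm (v k))"
      by (intro order_trans[OF norm_cinner_le] mult_left_mono order_trans[OF X(2)] mult_right_mono)
        auto
    also have "\<dots> = \<bar>K\<bar> * (norm (u k) * norm (v k))" by simp
    also have "\<dots> \<le> M k"
    proof -
      have "0 \<le> (norm (u k) - norm (v k))\<^sup>2" "0 \<le> norm (u k) * norm (v k)" by simp_all
      then have "norm (u k) * norm (v k) \<le> (norm (u k))\<^sup>2 + (norm (v k))\<^sup>2"
        unfolding power2_diff by linarith
      then show ?thesis unfolding M_def by (intro mult_left_mono) auto
    qed
    finally show ?thesis .
  qed
  ultimately show "(\<lambda>n. normal_functional \<omega> (X n)) \<longlonglongrightarrow> normal_functional \<omega> L"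
    unfolding normal_functional_def \<omega>(1) fst_conv snd_conv
    by (intro tannerys_theorem[THEN conjunct2, THEN conjunct2, of _ _ _ M] tendsto_cinner
        tendsto_const L(2)) (auto simp: case_prod_unfold)
qed (use X L in auto)

subsection \<open>Similarity and pure solutions\<close>

text \<open>For \<open>C = R \<circ> adj R\<close> the form of \<open>C - \<phi> C\<close> at
  \<open>x\<close> is that of \<open>1 - \<psi> id\<close> at \<open>adj R x\<close>, nonnegative by
  contractivity.\<close>

lemma similar_pure_imp_pure_solution:
  fixes \<phi> :: "('a::chilbert_space \<Rightarrow> 'a) \<Rightarrow> ('a \<Rightarrow> 'a)"
  assumes \<psi>: "completely_positive \<psi>" "pure_map \<psi>" "map_norm_le_one \<psi>" "similar_maps \<phi> \<psi>"
  shows "\<exists>C. invertible_op C \<and> pure_solution \<phi> C"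
proof -
  obtain R where R: "invertible_op R"
    and sim: "\<And>X. bop X \<Longrightarrow> \<phi> (R \<circ> X \<circ> adj R) = R \<circ> \<psi> X \<circ> adj R"
    using \<psi>(4) unfolding similar_maps_def by blast
  have bR: "bop R" using R by (simp add: invertible_op_def)
  note lin = completely_positive_linear[OF \<psi>(1)]
  define C where "C = R \<circ> adj R"
  have bC: "bop C" unfolding C_def by (intro bop_comp bop_adj bR)
  have pow: "(\<phi> ^^ k) C = R \<circ> (\<psi> ^^ k) id \<circ> adj R" for k
  proof (induction k)
    case (Suc k)
    have "bop ((\<psi> ^^ k) id)" by (rule linear_map_BH_bop[OF linear_map_BH_funpow[OF lin] bop_id(1)])
    then show ?case unfolding funpow.simps(2) comp_apply[of \<phi>] comp_apply[of \<psi>] Suc by (rule sim)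
  qed (simp add: C_def)
  have \<phi>C: "\<phi> C = R \<circ> \<psi> id \<circ> adj R" using pow[of 1] by simp
  have p: "pos_op (\<psi> id)" by (rule completely_positive_pos_op[OF \<psi>(1) pos_op_id(2)])
  then have b: "bop (\<psi> id)" by (simp add: pos_op_def)
  have le: "Re (cinner z (\<psi> id z)) \<le> (norm z)\<^sup>2" for z
  proof -
    have "onorm (\<psi> id) \<le> onorm (id :: 'a \<Rightarrow> 'a)" using \<psi>(3) by (simp add: map_norm_le_one_def)
    \<comment> \<open>On the zero space the operator norm of \<open>id\<close> is 0, hence no
      equality here.\<close>
    also have "\<dots> \<le> 1" by (rule onorm_bound) simp_all
    finally have "norm (\<psi> id z) \<le> 1 * norm z"
      using onorm[OF bop_bounded_linear[OF b], of z] by (meson mult_right_mono norm_ge_zero order_trans)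
    then have "Re (cinner z (\<psi> id z)) \<le> norm z * (1 * norm z)"
      by (intro order_trans[OF Re_cinner_le] mult_left_mono) auto
    then show ?thesis by (simp add: power2_eq_square)
  qed
  have "pos_op C"
    using bC by (simp add: pos_op_def C_def cinner_adj_right[OF bR] cnonneg_def cinner_self)
  moreover have "op_le (\<phi> C) C"
  proof -
    have "bop (\<phi> C)" unfolding \<phi>C by (intro bop_comp bop_adj bR b)
    moreover have "cnonneg (cinner x (C x - \<phi> C x))" for x
      using le[of "adj R x"] p unfolding \<phi>C
      by (simp add: C_def cinner_diff_right cinner_adj_right[OF bR] cnonneg_def cinner_self pos_op_def)
    ultimately show ?thesis using bC by (simp add: op_le_def pos_op_def bop_diff)
  qed
  moreover have "strongly_to_zero (\<lambda>k. (\<phi> ^^ k) C)"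
    using \<psi>(2) unfolding strongly_to_zero_def pure_map_def pow
    by (auto intro: bounded_linear.tendsto_zero[OF bop_bounded_linear[OF bR]])
  moreover have "invertible_op C"
    unfolding C_def by (intro invertible_op_comp invertible_op_adj R)
  ultimately show ?thesis unfolding pure_solution_def by blast
qed

text \<open>Since the root \<open>B\<close> is symmetric, \<open>adj B = B\<close>, and conjugation
  by \<open>B\<close> is exactly the similarity required.\<close>

lemma pure_solution_imp_similar_pure:
  assumes \<phi>: "completely_positive \<phi>" and C: "invertible_op C" "pure_solution \<phi> C"
  shows "\<exists>\<psi>. completely_positive \<psi> \<and> pure_map \<psi> \<and> map_norm_le_one \<psi> \<and> similar_maps \<phi> \<psi>"
proof -
  have pC: "pos_op C" using C(2) by (simp add: pure_solution_def)
  note lin = completely_positive_linear[OF \<phi>]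
  obtain B where B: "invertible_op B" "\<And>x y. cinner (B x) y = cinner x (B y)" "B \<circ> B = C"
    using pos_op_invertible_sqrt[OF pC C(1)] by blast
  then obtain D where bB: "bop B" and bD: "bop D"
    and BD [simp]: "\<And>x. B (D x) = x" and DB [simp]: "\<And>x. D (B x) = x"
    unfolding invertible_op_def by (auto simp: fun_eq_iff)
  have D: "cinner (D x) y = cinner x (D y)" for x y
    using B(2)[of "D x" "D y"] by simp
  define \<psi> where "\<psi> = (\<lambda>X. D \<circ> X \<circ> D) \<circ> \<phi> \<circ> (\<lambda>X. B \<circ> X \<circ> B)"
  have \<psi>_cp: "completely_positive \<psi>"
    unfolding \<psi>_def by (intro completely_positive_comp completely_positive_conjugation \<phi> bB bD B(2) D)
  have pow: "(\<psi> ^^ k) id = D \<circ> (\<phi> ^^ k) C \<circ> D" for k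
  proof (induction k)
    case 0
    show ?case by (simp add: B(3)[symmetric] fun_eq_iff)
  next
    case (Suc k)
    \<comment> \<open>The conjugation by \<open>B\<close> inside \<open>\<psi>\<close> cancels the
      outer \<open>D\<close> factors of the previous iterate.\<close>
    have "B \<circ> (D \<circ> (\<phi> ^^ k) C \<circ> D) \<circ> B = (\<phi> ^^ k) C" by (simp add: fun_eq_iff)
    then have "\<psi> (D \<circ> (\<phi> ^^ k) C \<circ> D) = D \<circ> \<phi> ((\<phi> ^^ k) C) \<circ> D"
      by (simp only: \<psi>_def comp_apply)
    then show ?case unfolding funpow.simps(2) comp_apply[of \<phi>] comp_apply[of \<psi>] Suc .
  qed
  have "pure_map \<psi>"
    using C(2) unfolding pure_map_def pure_solution_def strongly_to_zero_def pow
    by (auto intro: bounded_linear.tendsto_zero[OF bop_bounded_linear[OF bD]])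
  moreover have "map_norm_le_one \<psi>"
  proof (rule completely_positive_norm_le_one[OF \<psi>_cp])
    fix x
    have "0 \<le> Re (cinner (D x) (C (D x) - \<phi> C (D x)))"
      using C(2) by (simp add: pure_solution_def op_le_def pos_op_def cnonneg_def)
    moreover have "cinner (D x) (C (D x)) = cinner x x"
      by (simp add: D B(3)[symmetric])
    moreover have "\<psi> id x = D (\<phi> C (D x))" using pow[of 1] by simp
    ultimately show "Re (cinner x (\<psi> id x)) \<le> (norm x)\<^sup>2"
      by (simp add: cinner_diff_right D cinner_self)
  qed
  moreover have "similar_maps \<phi> \<psi>"
  proof -
    have adjB: "adj B = B" using B(2) by (rule adj_eqI)
    have "\<phi> (B \<circ> X \<circ> adj B) = B \<circ> \<psi> X \<circ> adj B" for X
      by (rule ext) (simp add: \<psi>_def adjB)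
    then show ?thesis unfolding similar_maps_def using B(1) by blast
  qed
  ultimately show ?thesis using \<psi>_cp by blast
qed

text \<open>With \<open>C - \<phi> C\<close> as \<open>R\<close>, purity makes the telescoped series
  converge to \<open>C\<close>; invertibility gives \<open>a\<close> and boundedness gives
  \<open>b\<close>.\<close>

lemma pure_solution_imp_bounded_sum:
  assumes \<phi>: "completely_positive \<phi>" and C: "invertible_op C" "pure_solution \<phi> C"
  shows "\<exists>(a::real) b R. 0 < a \<and> a \<le> b \<and> pos_op R \<and>
    (\<exists>S. (\<forall>x. (\<lambda>n. \<Sum>k<n. (\<phi> ^^ k) R x) \<longlonglongrightarrow> S x) \<and>
      op_le (\<lambda>x. complex_of_real a *\<^sub>C x) S \<and> op_le S (\<lambda>x. complex_of_real b *\<^sub>C x))"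
proof -
  have pC: "pos_op C" using C(2) by (simp add: pure_solution_def)
  then have bC: "bop C" and im: "\<And>x. Im (cinner x (C x)) = 0"
    by (auto simp: pos_op_def cnonneg_def)
  note lin = completely_positive_linear[OF \<phi>]
  obtain a where a: "a > 0" "\<And>x. a * (norm x)\<^sup>2 \<le> Re (cinner x (C x))"
    using pos_op_invertible_bounded_below[OF pC C(1)] by blast
  obtain b where b: "a \<le> b" "\<And>x. Re (cinner x (C x)) \<le> b * (norm x)\<^sup>2"
    using bop_Re_cinner_le[OF bC] by blast
  have "op_le (\<lambda>x. complex_of_real a *\<^sub>C x) C" "op_le C (\<lambda>x. complex_of_real b *\<^sub>C x)"
    using a(2) b(2) im bC by (auto simp: op_le_def pos_op_def cnonneg_def cinner_simps cinner_self
        intro!: bop_diff bop_scaleC)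
  moreover have "(\<lambda>n. \<Sum>k<n. (\<phi> ^^ k) (\<lambda>x. C x - \<phi> C x) x) \<longlonglongrightarrow> C x" for x
  proof -
    have "(\<lambda>n. C x - (\<phi> ^^ n) C x) \<longlonglongrightarrow> C x - 0"
      using C(2) unfolding pure_solution_def strongly_to_zero_def
      by (intro tendsto_diff tendsto_const) blast
    then show ?thesis by (simp add: sum_funpow_telescope[OF lin bC])
  qed
  moreover have "pos_op (\<lambda>x. C x - \<phi> C x)" using C(2) by (simp add: pure_solution_def op_le_def)
  ultimately show ?thesis using a(1) b(1) by blast
qed

text \<open>The sum \<open>S\<close> is itself the solution: the bound \<open>a\<close> makes it
  invertible, \<open>S - \<phi> S\<close> is \<open>R\<close>, and the iterates of \<open>S\<close>
  are the tails of the series.\<close>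

lemma bounded_sum_imp_pure_solution:
  assumes \<phi>: "completely_positive \<phi>" "wstar_continuous \<phi>" and R: "pos_op R"
    and S: "\<And>x. (\<lambda>n. \<Sum>k<n. (\<phi> ^^ k) R x) \<longlonglongrightarrow> S x"
    and a: "0 < a" "op_le (\<lambda>x. complex_of_real a *\<^sub>C x) S"
    and b: "op_le S (\<lambda>x. complex_of_real b *\<^sub>C x)"
  shows "invertible_op S \<and> pure_solution \<phi> S"
proof -
  note lin = completely_positive_linear[OF \<phi>(1)]
  have bS: "bop S" using b by (simp add: op_le_def)
  have low: "a * (norm x)\<^sup>2 \<le> Re (cinner x (S x))" and im: "Im (cinner x (S x)) = 0"
    and upp: "Re (cinner x (S x)) \<le> b * (norm x)\<^sup>2" for x
    using a(2) b by (auto simp: op_le_def pos_op_def cnonneg_def cinner_simps cinner_self)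
  have pS: "pos_op S"
    using bS im low a(1) unfolding pos_op_def cnonneg_def
    by (meson mult_nonneg_nonneg less_imp_le order_trans zero_le_power2)
  have pR: "pos_op ((\<phi> ^^ k) R)" for k
    by (rule completely_positive_funpow_pos_op[OF \<phi>(1) R])
  then have bR: "bop ((\<phi> ^^ k) R)" and nn: "0 \<le> Re (cinner x ((\<phi> ^^ k) R x))"
    and imR: "Im (cinner x ((\<phi> ^^ k) R x)) = 0" for k x
    by (simp_all add: pos_op_def cnonneg_def)
  define P where "P = (\<lambda>n x. \<Sum>k<n. (\<phi> ^^ k) R x)"
  have P: "(\<lambda>n. P n x) \<longlonglongrightarrow> S x" for x unfolding P_def by (rule S)
  have bP: "bop (P n)" for n unfolding P_def by (intro bop_sum bR)
  have Re_P: "Re (cinner x (P n x)) = (\<Sum>k<n. Re (cinner x ((\<phi> ^^ k) R x)))" for n x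
    by (simp add: P_def cinner_sum_right)
  have "pos_op (P n)" for n
    using bP nn imR by (simp add: pos_op_def cnonneg_def Re_P sum_nonneg)
      (simp add: P_def cinner_sum_right)
  moreover have "Re (cinner x (P n x)) \<le> b * (norm x)\<^sup>2" for n x
  proof -
    \<comment> \<open>The forms of the partial sums increase to that of \<open>S\<close>, so the
      bound \<open>b\<close> is uniform in \<open>n\<close>; this is the domination needed for the
      weak* limit.\<close>
    have "incseq (\<lambda>n. Re (cinner x (P n x)))"
      unfolding Re_P by (intro incseq_SucI) (simp add: nn)
    moreover have "(\<lambda>n. Re (cinner x (P n x))) \<longlonglongrightarrow> Re (cinner x (S x))"
      by (intro tendsto_intros P)
    ultimately have "Re (cinner x (P n x)) \<le> Re (cinner x (S x))" by (rule incseq_le)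
    then show ?thesis using upp[of x] by linarith
  qed
  ultimately have "norm (P n x) \<le> b * norm x" for n x by (rule pos_op_norm_le)
  then have "limitin wstar_topology P S sequentially"
    using bounded_strong_limit_imp_limitin_wstar[of P b S] bP bS P by blast
  then have lim: "limitin wstar_topology (\<lambda>n. \<phi> (P n)) (\<phi> S) sequentially"
    using continuous_map_limit[OF \<phi>(2)[unfolded wstar_continuous_def]] by (simp add: comp_def)
  \<comment> \<open>Applying \<open>\<phi>\<close> raises every exponent by one, so only the term of
    index 0, which is \<open>R\<close>, is missing from \<open>P (Suc n)\<close>.\<close>
  have \<phi>P: "\<phi> (P n) x = P (Suc n) x - R x" for n x
  proof -
    have "\<phi> (P n) x = (\<Sum>k<n. (\<phi> ^^ Suc k) R x)"
      unfolding P_def using linear_map_BH_sum[OF lin, of "{..<n}" "\<lambda>k. (\<phi> ^^ k) R"] bR by simp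
    then show ?thesis unfolding P_def by (subst sum.lessThan_Suc_shift) simp
  qed
  \<comment> \<open>The weak* limit and the strong limit of \<open>\<phi> (P n)\<close> have the
    same matrix coefficients.\<close>
  have \<phi>S: "\<phi> S = (\<lambda>x. S x - R x)"
  proof (intro ext cinner_eqI)
    fix x z
    have "(\<lambda>n. cinner z (\<phi> (P n) x)) \<longlonglongrightarrow> cinner z (S x - R x)"
      unfolding \<phi>P by (intro tendsto_intros LIMSEQ_Suc P)
    then show "cinner z (\<phi> S x) = cinner z (S x - R x)"
      using limitin_wstar_cinner[OF lim] LIMSEQ_unique by blast
  qed
  have R_eq: "R = (\<lambda>x. S x - \<phi> S x)" by (simp add: \<phi>S)
  have "P n x = S x - (\<phi> ^^ n) S x" for n x
    unfolding P_def by (subst R_eq) (rule sum_funpow_telescope[OF lin bS])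
  then have "(\<phi> ^^ n) S x = S x - P n x" for n x by simp
  then have "strongly_to_zero (\<lambda>n. (\<phi> ^^ n) S)"
    unfolding strongly_to_zero_def using tendsto_diff[OF tendsto_const P, of "S x" x for x] by simp
  moreover have "op_le (\<phi> S) S"
    using linear_map_BH_bop[OF lin bS] bS R by (simp add: op_le_def R_eq[symmetric])
  moreover have "invertible_op S"
    using pos_op_bounded_below_invertible[OF pS a(1) low] .
  ultimately show ?thesis using pS by (simp add: pure_solution_def)
qed

theorem theorem5p11:
  fixes \<phi> :: "('a::chilbert_space \<Rightarrow> 'a) \<Rightarrow> ('a \<Rightarrow> 'a)"
  assumes "completely_positive \<phi>" and "wstar_continuous \<phi>"
  shows "((\<exists>\<psi>. completely_positive \<psi> \<and> pure_map \<psi> \<and> map_norm_le_one \<psi> \<and> similar_maps \<phi> \<psi>)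
          \<longleftrightarrow> (\<exists>(a::real) b R. 0 < a \<and> a \<le> b \<and> pos_op R \<and>
                (\<exists>S. (\<forall>x. (\<lambda>n. \<Sum>k<n. (\<phi> ^^ k) R x) \<longlonglongrightarrow> S x) \<and>
                     op_le (\<lambda>x. complex_of_real a *\<^sub>C x) S \<and> op_le S (\<lambda>x. complex_of_real b *\<^sub>C x))))
       \<and> ((\<exists>(a::real) b R. 0 < a \<and> a \<le> b \<and> pos_op R \<and>
                (\<exists>S. (\<forall>x. (\<lambda>n. \<Sum>k<n. (\<phi> ^^ k) R x) \<longlonglongrightarrow> S x) \<and>
                     op_le (\<lambda>x. complex_of_real a *\<^sub>C x) S \<and> op_le S (\<lambda>x. complex_of_real b *\<^sub>C x)))
          \<longleftrightarrow> (\<exists>C. invertible_op C \<and> pure_solution \<phi> C))"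
  \<comment> \<open>Both equivalences pass through the existence of an invertible pure
    solution.\<close>
  using assms similar_pure_imp_pure_solution[of _ \<phi>] pure_solution_imp_similar_pure[of \<phi>]
    pure_solution_imp_bounded_sum[of \<phi>] bounded_sum_imp_pure_solution[of \<phi>]
  by blast

end
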